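(* Let $G$ be a finite undirected graph (multiple edges and loops allowed), $v\in V(G)$, and $a\in\mathrm{Pisg}(G,v)$ with $a:(L,P_L)\to(M,P_M)$. Let $\langle a\rangle$ (the ideal generated by $a$) be the set of all $\varphi\in\mathrm{Pisg}(G,v)$, $\varphi:(H,P_H)\to(K,P_K)$, where $P_H,P_K$ are paths rooted at $v$ and isomorphic to a subpath $P_L'$ of $P_L$ rooted at $v$, and $H,K$ are isomorphic to $G[V(P_L')]$. Then $\langle a\rangle$ is an ideal of $\mathrm{Pisg}(G,v)$ and is the minimal such ideal containing $a$.
   Context: Graphs are finite and undirected and may have multiple edges and loops. For $X\subseteq V(G)$, $G[X]$ is the subgraph of $G$ induced by $X$. A path rooted at $v$ is a path starting at $v$ (possibly consisting of $v$ alone); a subpath rooted at $v$ is an initial segment. A $v$-rooted path pair is a pair $(H,P_H)$ where $P_H$ is a path of $G$ rooted at $v$ and $H=G[V(P_H)]$. $\mathrm{Pisg}(G,v)$ is the set of all isomorphisms of $v$-rooted path pairs of $G$, that is, of all $(\varphi,\varphi|_{P_H}):(H,P_H)\to(J,P_J)$ (written simply $\varphi$) where $\varphi:H\to J$ is a graph isomorphism (bijections on vertices and on edges preserving incidence) with $\varphi(v)=v$ and $\varphi(P_H)=P_J$. For $\varphi:(H,P_H)\to(J,P_J)$ and $\psi:(K,P_K)\to(M,P_M)$ in $\mathrm{Pisg}(G,v)$, let $P_{\psi\circ\varphi}$ be the longest $v$-rooted path common to $P_J$ and $P_K$ and $C_{\psi\circ\varphi}=G[V(P_{\psi\circ\varphi})]$;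 the product is $\psi\circ\varphi:(\varphi^{-1}(C_{\psi\circ\varphi}),\varphi^{-1}(P_{\psi\circ\varphi}))\to(\psi(C_{\psi\circ\varphi}),\psi(P_{\psi\circ\varphi}))$, the restriction of "apply $\varphi$, then $\psi$". With this product $\mathrm{Pisg}(G,v)$ is an inverse semigroup. An ideal of a semigroup $S$ is a subset $I\subseteq S$ with $SI\subseteq I$ and $IS\subseteq I$.
   Formalization: In the definition of ⟨a⟩, the isomorphisms of P_H, P_K with P_L' and of H, K with G[V(P_L')] are taken jointly, as isomorphisms of v-rooted path pairs (one map fixing v and carrying path to path); with unrelated isomorphisms the set need not be an ideal. *)

theory Defs
  imports "HOL-Library.FuncSet" "HOL-Library.Sublist"
begin

text \<open>The set \<open>ends G e\<close> of end vertices of an edge has one element if \<open>e\<close> is a loop and two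
  elements otherwise; its value on non-edges is irrelevant.\<close>

record ('v, 'e) ugraph =
  verts :: "'v set"
  edges :: "'e set"
  ends :: "'e \<Rightarrow> 'v set"

definition fin_ugraph :: "('v, 'e) ugraph \<Rightarrow> bool" where
  "fin_ugraph G \<longleftrightarrow> finite (verts G) \<and> finite (edges G) \<and>
     (\<forall>e\<in>edges G. ends G e \<subseteq> verts G \<and> card (ends G e) \<in> {1, 2})"

definition induced_subgraph :: "('v, 'e) ugraph \<Rightarrow> 'v set \<Rightarrow> ('v, 'e) ugraph" where
  "induced_subgraph G X = G\<lparr>verts := X, edges := {e \<in> edges G. ends G e \<subseteq> X}\<rparr>"

definition graph_iso ::
  "('v, 'e) ugraph \<Rightarrow> ('v, 'e) ugraph \<Rightarrow> ('v \<Rightarrow> 'v) \<Rightarrow> ('e \<Rightarrow> 'e) \<Rightarrow> bool" where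
  "graph_iso H J f g \<longleftrightarrow>
     bij_betw f (verts H) (verts J) \<and> bij_betw g (edges H) (edges J) \<and>
     (\<forall>e\<in>edges H. ends J (g e) = f ` ends H e)"

text \<open>The image of a subgraph \<open>H\<close> of some graph, as a subgraph of that same graph.\<close>

definition graph_image ::
  "('v \<Rightarrow> 'v) \<Rightarrow> ('e \<Rightarrow> 'e) \<Rightarrow> ('v, 'e) ugraph \<Rightarrow> ('v, 'e) ugraph" where
  "graph_image f g H = H\<lparr>verts := f ` verts H, edges := g ` edges H\<rparr>"

text \<open>The path \<open>v\<^sub>0 e\<^sub>1 v\<^sub>1 \<dots> e\<^sub>n v\<^sub>n\<close> is represented by
  \<open>(v\<^sub>0, [(e\<^sub>1, v\<^sub>1), \<dots>, (e\<^sub>n, v\<^sub>n)])\<close>. As the root is an end of the path, this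
  sequence carries the same information as the path regarded as a subgraph.\<close>

type_synonym ('v, 'e) path = "'v \<times> ('e \<times> 'v) list"

fun walk :: "('v, 'e) ugraph \<Rightarrow> 'v \<Rightarrow> ('e \<times> 'v) list \<Rightarrow> bool" where
  "walk G u [] \<longleftrightarrow> u \<in> verts G"
| "walk G u ((e, w) # xs) \<longleftrightarrow>
     u \<in> verts G \<and> e \<in> edges G \<and> ends G e = {u, w} \<and> walk G w xs"

definition path_verts :: "('v, 'e) path \<Rightarrow> 'v set" where
  "path_verts P = insert (fst P) (snd ` set (snd P))"

definition rooted_path :: "('v, 'e) ugraph \<Rightarrow> 'v \<Rightarrow> ('v, 'e) path \<Rightarrow> bool" where
  "rooted_path G v P \<longleftrightarrow>
     fst P = v \<and> walk G (fst P) (snd P) \<and> distinct (fst P # map snd (snd P))"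

definition rooted_subpath :: "('v, 'e) path \<Rightarrow> ('v, 'e) path \<Rightarrow> bool" where
  "rooted_subpath P Q \<longleftrightarrow> fst P = fst Q \<and> prefix (snd P) (snd Q)"

text \<open>The longest common initial segment of two paths with the same root.\<close>

definition common_path :: "('v, 'e) path \<Rightarrow> ('v, 'e) path \<Rightarrow> ('v, 'e) path" where
  "common_path P Q = (fst P, longest_common_prefix (snd P) (snd Q))"

definition path_image :: "('v \<Rightarrow> 'v) \<Rightarrow> ('e \<Rightarrow> 'e) \<Rightarrow> ('v, 'e) path \<Rightarrow> ('v, 'e) path" where
  "path_image f g P = (f (fst P), map (map_prod g f) (snd P))"

type_synonym ('v, 'e) path_pair = "('v, 'e) ugraph \<times> ('v, 'e) path"

definition path_pairs :: "('v, 'e) ugraph \<Rightarrow> 'v \<Rightarrow> ('v, 'e) path_pair set" where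
  "path_pairs G v = {(H, P). rooted_path G v P \<and> H = induced_subgraph G (path_verts P)}"

definition pair_iso ::
  "'v \<Rightarrow> ('v, 'e) path_pair \<Rightarrow> ('v, 'e) path_pair \<Rightarrow> ('v \<Rightarrow> 'v) \<Rightarrow> ('e \<Rightarrow> 'e) \<Rightarrow> bool" where
  "pair_iso v A B f g \<longleftrightarrow>
     graph_iso (fst A) (fst B) f g \<and> f v = v \<and> path_image f g (snd A) = snd B"

definition pair_isomorphic :: "'v \<Rightarrow> ('v, 'e) path_pair \<Rightarrow> ('v, 'e) path_pair \<Rightarrow> bool" where
  "pair_isomorphic v A B \<longleftrightarrow> (\<exists>f g. pair_iso v A B f g)"

record ('v, 'e) pair_map =
  src :: "('v, 'e) path_pair"
  tgt :: "('v, 'e) path_pair"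
  vmap :: "'v \<Rightarrow> 'v"
  emap :: "'e \<Rightarrow> 'e"

text \<open>Requiring the vertex and edge maps to be \<^const>\<open>extensional\<close> makes equality of records
  the same as equality of maps defined on the source only.\<close>

definition Pisg :: "('v, 'e) ugraph \<Rightarrow> 'v \<Rightarrow> ('v, 'e) pair_map set" where
  "Pisg G v = {\<phi>. src \<phi> \<in> path_pairs G v \<and> tgt \<phi> \<in> path_pairs G v \<and>
     pair_iso v (src \<phi>) (tgt \<phi>) (vmap \<phi>) (emap \<phi>) \<and>
     vmap \<phi> \<in> extensional (verts (fst (src \<phi>))) \<and>
     emap \<phi> \<in> extensional (edges (fst (src \<phi>)))}"

text \<open>The product \<open>\<psi> \<circ> \<phi>\<close> (first \<open>\<phi>\<close>, then \<open>\<psi>\<close>). Here \<open>f'\<close> and \<open>g'\<close> are the inverses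
  of the vertex and edge maps of \<open>\<phi>\<close>.\<close>

definition pisg_mult ::
  "('v, 'e) ugraph \<Rightarrow> ('v, 'e) pair_map \<Rightarrow> ('v, 'e) pair_map \<Rightarrow> ('v, 'e) pair_map" where
  "pisg_mult G \<psi> \<phi> =
     (let P = common_path (snd (tgt \<phi>)) (snd (src \<psi>));
          C = induced_subgraph G (path_verts P);
          f' = inv_into (verts (fst (src \<phi>))) (vmap \<phi>);
          g' = inv_into (edges (fst (src \<phi>))) (emap \<phi>)
      in \<lparr>src = (graph_image f' g' C, path_image f' g' P),
          tgt = (graph_image (vmap \<psi>) (emap \<psi>) C, path_image (vmap \<psi>) (emap \<psi>) P),
          vmap = compose (f' ` verts C) (vmap \<psi>) (vmap \<phi>),
          emap = compose (g' ` edges C) (emap \<psi>) (emap \<phi>)\<rparr>)"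

definition semigroup_ideal :: "'s set \<Rightarrow> ('s \<Rightarrow> 's \<Rightarrow> 's) \<Rightarrow> 's set \<Rightarrow> bool" where
  "semigroup_ideal S m I \<longleftrightarrow> I \<subseteq> S \<and> (\<forall>s\<in>S. \<forall>x\<in>I. m s x \<in> I \<and> m x s \<in> I)"

text \<open>The set \<open>\<langle>a\<rangle>\<close>. The isomorphisms between the graphs and between the paths are given by one
  and the same map, that is, they are isomorphisms of \<open>v\<close>-rooted path pairs.\<close>

definition generated_ideal ::
  "('v, 'e) ugraph \<Rightarrow> 'v \<Rightarrow> ('v, 'e) pair_map \<Rightarrow> ('v, 'e) pair_map set" where
  "generated_ideal G v a = {\<phi> \<in> Pisg G v.
     \<exists>P. rooted_subpath P (snd (src a)) \<and>
         pair_isomorphic v (src \<phi>) (induced_subgraph G (path_verts P), P) \<and>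
         pair_isomorphic v (tgt \<phi>) (induced_subgraph G (path_verts P), P)}"

end

(* Both halves of the theorem rest on restricting an isomorphism of rooted path pairs to a rooted
   subpath. The source and the target of a product are isomorphic to the pair induced by the common
   path, and an isomorphism onto a subpath of P_L carries this common path to a shorter subpath of
   P_L; hence the set is an ideal. For minimality, an isomorphism h from the source of phi onto the
   pair of a subpath of P_L gives a product x = a h with the same source as phi, and then
   phi = (phi x^-1) x. *)

theory Submission
  imports Defs
begin

section \<open>Rooted paths, initial segments and images of paths\<close>

abbreviation induced_pair :: "('v, 'e) ugraph \<Rightarrow> ('v, 'e) path \<Rightarrow> ('v, 'e) path_pair" where
  "induced_pair G P \<equiv> (induced_subgraph G (path_verts P), P)"

text \<open>The graph of a path pair is determined by its path, so later arguments can be carried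
  out on paths.\<close>

lemma in_path_pairs_iff:
  "A \<in> path_pairs G v \<longleftrightarrow> rooted_path G v (snd A) \<and> A = induced_pair G (snd A)"
  by (cases A) (auto simp: path_pairs_def)

lemma induced_pair_in_path_pairs [simp]:
  "induced_pair G P \<in> path_pairs G v \<longleftrightarrow> rooted_path G v P"
  by (simp add: in_path_pairs_iff)

lemma walk_root: "walk G u xs \<Longrightarrow> u \<in> verts G"
  by (cases xs) auto

lemma walk_appendD: "walk G u (xs @ ys) \<Longrightarrow> walk G u xs"
  by (induction G u xs rule: walk.induct) (auto dest: walk_root)

lemma rooted_path_subpath:
  assumes "rooted_path G v Q" and "rooted_subpath P Q"
  shows "rooted_path G v P"
  using assms by (auto simp: rooted_path_def rooted_subpath_def prefix_def dest: walk_appendD)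

lemma path_verts_subpath: "rooted_subpath P Q \<Longrightarrow> path_verts P \<subseteq> path_verts Q"
  by (auto simp: path_verts_def rooted_subpath_def prefix_def)

lemma rooted_subpath_refl [simp]: "rooted_subpath P P"
  by (simp add: rooted_subpath_def)

lemma rooted_subpath_trans:
  "rooted_subpath P Q \<Longrightarrow> rooted_subpath Q R \<Longrightarrow> rooted_subpath P R"
  by (auto simp: rooted_subpath_def)

lemma rooted_subpath_path_image:
  "rooted_subpath P Q \<Longrightarrow> rooted_subpath (path_image f g P) (path_image f g Q)"
  by (simp add: rooted_subpath_def path_image_def map_mono_prefix)

lemma rooted_subpath_common_path:
  assumes "fst P = fst Q"
  shows "rooted_subpath (common_path P Q) P" "rooted_subpath (common_path P Q) Q"
  using assms
  by (simp_all add: rooted_subpath_def common_path_def longest_common_prefix_prefix1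
      longest_common_prefix_prefix2)

text \<open>Used for minimality, where the target path of the first factor is an initial segment of
  the source path of the second: the product then keeps the whole source of the first
  factor.\<close>

lemma common_path_subpath:
  assumes "rooted_subpath P Q"
  shows "common_path P Q = P"
  using assms longest_common_prefix_max_prefix[of "snd P" "snd P" "snd Q"]
    longest_common_prefix_prefix1[of "snd P" "snd Q"]
  by (cases P) (auto simp: rooted_subpath_def common_path_def intro: prefix_order.antisym)

lemma walk_edges:
  "walk G u xs \<Longrightarrow> e \<in> fst ` set xs \<Longrightarrow>
    e \<in> edges G \<and> ends G e \<subseteq> insert u (snd ` set xs)"
  by (induction G u xs rule: walk.induct) auto

text \<open>Both ends of a path edge are vertices of the path. Hence edge maps that agree on the
  induced subgraph also agree on the path edges.\<close>

lemma rooted_path_edges: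
  "rooted_path G v P \<Longrightarrow> e \<in> fst ` set (snd P) \<Longrightarrow>
    e \<in> edges (induced_subgraph G (path_verts P))"
  using walk_edges[of G "fst P" "snd P" e]
  by (auto simp: rooted_path_def induced_subgraph_def path_verts_def)

lemma rooted_path_root: "rooted_path G v P \<Longrightarrow> v \<in> path_verts P"
  by (auto simp: rooted_path_def path_verts_def)

lemma verts_induced_subgraph [simp]: "verts (induced_subgraph G X) = X"
  by (simp add: induced_subgraph_def)

lemma path_verts_path_image [simp]: "path_verts (path_image f g P) = f ` path_verts P"
  by (simp add: path_verts_def path_image_def image_comp)

lemma path_image_cong:
  assumes "\<And>x. x \<in> path_verts P \<Longrightarrow> f x = f' x"
    and "\<And>e. e \<in> fst ` set (snd P) \<Longrightarrow> g e = g' e"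
  shows "path_image f g P = path_image f' g' P"
  using assms by (simp add: path_image_def path_verts_def map_prod_def split_beta)

lemma path_image_path_image:
  "path_image f g (path_image f' g' P) = path_image (f \<circ> f') (g \<circ> g') P"
  by (simp add: path_image_def map_prod.comp)

lemma path_image_id: "path_image (\<lambda>x. x) (\<lambda>e. e) P = P"
  by (simp add: path_image_def map_prod.identity[unfolded id_def])

section \<open>Isomorphisms of path pairs\<close>

text \<open>\<open>pair_iso\<close> evaluates the maps only at vertices and edges of the source, the
  root being one of these vertices. This permits passing to restrictions, as extensionality in
  \<open>Pisg\<close> requires.\<close>

lemma pair_iso_cong:
  assumes P: "rooted_path G v P" and iso: "pair_iso v (induced_pair G P) B f g"
    and f: "\<And>x. x \<in> path_verts P \<Longrightarrow> f' x = f x"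
    and g: "\<And>e. e \<in> edges (induced_subgraph G (path_verts P)) \<Longrightarrow> g' e = g e"
  shows "pair_iso v (induced_pair G P) B f' g'"
proof -
  let ?H = "induced_subgraph G (path_verts P)"
  have "path_image f' g' P = path_image f g P"
    using f g rooted_path_edges[OF P] by (intro path_image_cong) auto
  moreover have "f' ` ends ?H e = f ` ends ?H e" if "e \<in> edges ?H" for e
    using that f by (intro image_cong) (auto simp: induced_subgraph_def)
  moreover have "bij_betw f' (path_verts P) Y = bij_betw f (path_verts P) Y" for Y
    using f by (rule bij_betw_cong)
  moreover have "bij_betw g' (edges ?H) Y = bij_betw g (edges ?H) Y" for Y
    using g by (rule bij_betw_cong)
  ultimately show ?thesis
    using iso f g rooted_path_root[OF P] by (simp add: pair_iso_def graph_iso_def)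
qed

lemma pair_iso_comp:
  assumes "pair_iso v A B f g" and "pair_iso v B C f' g'"
  shows "pair_iso v A C (f' \<circ> f) (g' \<circ> g)"
proof -
  have "g e \<in> edges (fst B)" if "e \<in> edges (fst A)" for e
    using that assms(1) by (auto simp: pair_iso_def graph_iso_def bij_betw_def)
  then show ?thesis
    using assms
    by (auto simp: pair_iso_def graph_iso_def image_comp intro: bij_betw_trans
        simp flip: path_image_path_image)
qed

text \<open>Rootedness of \<open>P\<close> places \<open>v\<close> and the edges of \<open>P\<close>
  inside the source graph, which is where \<open>inv_into\<close> undoes \<open>f\<close> and
  \<open>g\<close>.\<close>

lemma pair_iso_inv:
  fixes G :: "('v, 'e) ugraph"
  assumes P: "rooted_path G v P" and iso: "pair_iso v (induced_pair G P) (induced_pair G Q) f g"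
  shows "pair_iso v (induced_pair G Q) (induced_pair G P) (inv_into (path_verts P) f)
    (inv_into (edges (induced_subgraph G (path_verts P))) g)"
proof -
  let ?H = "induced_subgraph G (path_verts P)" and ?J = "induced_subgraph G (path_verts Q)"
  let ?f = "inv_into (path_verts P) f" and ?g = "inv_into (edges ?H) g"
  from iso have f: "bij_betw f (path_verts P) (path_verts Q)"
    and g: "bij_betw g (edges ?H) (edges ?J)" and v: "f v = v" and Q: "path_image f g P = Q"
    and ends: "\<And>e. e \<in> edges ?H \<Longrightarrow> ends ?J (g e) = f ` ends ?H e"
    by (auto simp: pair_iso_def graph_iso_def)
  have f_inv: "?f (f x) = x" if "x \<in> path_verts P" for x
    using f that by (simp add: bij_betw_inv_into_left)
  have g_inv: "?g (g e) = e" if "e \<in> edges ?H" for e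
    using g that by (simp add: bij_betw_inv_into_left)
  have "ends ?H (?g e) = ?f ` ends ?J e" if "e \<in> edges ?J" for e
  proof -
    \<comment> \<open>Incidence is transferred backwards: an edge of the target is
      \<open>g e'\<close>, and \<open>?f\<close> undoes \<open>f\<close> on the ends of
      \<open>e'\<close>.\<close>
    from that g obtain e' where e': "e' \<in> edges ?H" "e = g e'"
      by (auto simp: bij_betw_def)
    then have "ends ?H e' \<subseteq> path_verts P"
      by (auto simp: induced_subgraph_def)
    then have "?f ` f ` ends ?H e' = ends ?H e'"
      using f_inv by (force simp: image_comp)
    then show ?thesis
      using e' ends g_inv by simp
  qed
  moreover have "?f v = v"
    using f_inv[OF rooted_path_root[OF P]] v by simp
  moreover have "path_image ?f ?g Q = P"
  proof -
    have "path_image ?f ?g Q = path_image (?f \<circ> f) (?g \<circ> g) P"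
      using Q path_image_path_image by metis
    also have "\<dots> = path_image (\<lambda>x. x) (\<lambda>e. e) P"
      using f_inv g_inv rooted_path_edges[OF P] by (intro path_image_cong) auto
    finally show ?thesis
      by (simp add: path_image_id)
  qed
  ultimately show ?thesis
    using bij_betw_inv_into[OF f] bij_betw_inv_into[OF g] by (simp add: pair_iso_def graph_iso_def)
qed

text \<open>Since the subgraphs are induced, only vertex sets have to be tracked: \<open>f\<close>
  is injective on \<open>X\<close>, so an edge of G[X] lies in G[X'] exactly when its image lies in
  G[f(X')].\<close>

lemma graph_iso_restrict:
  assumes iso: "graph_iso (induced_subgraph G X) (induced_subgraph G Y) f g" and "X' \<subseteq> X"
  shows "graph_iso (induced_subgraph G X') (induced_subgraph G (f ` X')) f g"
proof -
  let ?E = "\<lambda>X. {e \<in> edges G. ends G e \<subseteq> X}"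
  from iso have f: "bij_betw f X Y" and g: "bij_betw g (?E X) (?E Y)"
    and ends: "\<And>e. e \<in> ?E X \<Longrightarrow> ends G (g e) = f ` ends G e"
    by (auto simp: graph_iso_def induced_subgraph_def)
  have sub: "?E X' \<subseteq> ?E X" "f ` X' \<subseteq> Y"
    using \<open>X' \<subseteq> X\<close> f by (auto simp: bij_betw_def)
  have "g ` ?E X' = ?E (f ` X')"
  proof (intro equalityI subsetI)
    fix e assume "e \<in> g ` ?E X'"
    then obtain e' where e': "e' \<in> ?E X'" "e = g e'"
      by blast
    then have "e \<in> ?E Y"
      using g sub unfolding bij_betw_def by blast
    moreover have "ends G e = f ` ends G e'"
      using e' sub ends by blast
    ultimately show "e \<in> ?E (f ` X')"
      using e' by auto
  next
    fix e assume e: "e \<in> ?E (f ` X')"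
    then have "e \<in> ?E Y"
      using sub by blast
    then obtain e' where e': "e' \<in> ?E X" "e = g e'"
      using g unfolding bij_betw_def by blast
    then have "f ` ends G e' \<subseteq> f ` X'" "ends G e' \<subseteq> X"
      using e ends by auto
    then have "ends G e' \<subseteq> X'"
      using f \<open>X' \<subseteq> X\<close> unfolding bij_betw_def inj_on_def by blast
    then show "e \<in> g ` ?E X'"
      using e' by blast
  qed
  then have "bij_betw g (?E X') (?E (f ` X'))"
    using g sub(1) by (auto simp: bij_betw_def intro: inj_on_subset)
  moreover have "bij_betw f X' (f ` X')"
    using f \<open>X' \<subseteq> X\<close> by (auto simp: bij_betw_def intro: inj_on_subset)
  ultimately show ?thesis
    using sub ends by (auto simp: graph_iso_def induced_subgraph_def)
qed

text \<open>Maps act on a path entry by entry, so they preserve prefixes, and the whole of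
  \<open>P\<close> goes to \<open>Q\<close>.\<close>

lemma pair_iso_restrict:
  assumes "pair_iso v (induced_pair G P) (induced_pair G Q) f g" and "rooted_subpath P' P"
  shows "pair_iso v (induced_pair G P') (induced_pair G (path_image f g P')) f g"
    and "rooted_subpath (path_image f g P') Q"
  using assms graph_iso_restrict[OF _ path_verts_subpath[OF assms(2)]]
    rooted_subpath_path_image[OF assms(2)]
  by (auto simp: pair_iso_def)

text \<open>\<open>graph_image\<close> and \<open>induced_subgraph\<close> keep the field
  \<open>ends\<close> of \<open>G\<close>, so matching vertex and edge sets gives equality of
  records. This turns the graphs in \<open>pisg_mult\<close> into induced subgraphs.\<close>

lemma graph_image_eq:
  assumes "graph_iso (induced_subgraph G X) (induced_subgraph G Y) f g"
  shows "graph_image f g (induced_subgraph G X) = induced_subgraph G Y"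
  using assms by (simp add: graph_iso_def graph_image_def induced_subgraph_def bij_betw_def)

section \<open>Elements and products of \<open>Pisg\<close>\<close>

lemma PisgD:
  assumes "\<phi> \<in> Pisg G v"
  obtains P Q where "src \<phi> = induced_pair G P" "tgt \<phi> = induced_pair G Q"
    "rooted_path G v P" "rooted_path G v Q"
    "pair_iso v (induced_pair G P) (induced_pair G Q) (vmap \<phi>) (emap \<phi>)"
    "vmap \<phi> \<in> extensional (path_verts P)"
    "emap \<phi> \<in> extensional (edges (induced_subgraph G (path_verts P)))"
proof -
  from assms have "src \<phi> = induced_pair G (snd (src \<phi>))" "tgt \<phi> = induced_pair G (snd (tgt \<phi>))"
    "rooted_path G v (snd (src \<phi>))" "rooted_path G v (snd (tgt \<phi>))"
    by (auto simp: Pisg_def in_path_pairs_iff)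
  with assms show thesis
    by (intro that[of "snd (src \<phi>)" "snd (tgt \<phi>)"])
      (auto simp: Pisg_def dest: arg_cong[of _ _ "verts \<circ> fst"] arg_cong[of _ _ "edges \<circ> fst"])
qed

text \<open>\<open>f\<close> and \<open>g\<close> may be arbitrary outside the source; restricting
  them makes every isomorphism of path pairs an element of \<open>Pisg\<close>.\<close>

lemma pair_iso_PisgE:
  assumes P: "rooted_path G v P" and "rooted_path G v Q"
    and iso: "pair_iso v (induced_pair G P) (induced_pair G Q) f g"
  obtains \<phi> where "\<phi> \<in> Pisg G v" "src \<phi> = induced_pair G P" "tgt \<phi> = induced_pair G Q"
    "vmap \<phi> = restrict f (path_verts P)"
    "emap \<phi> = restrict g (edges (induced_subgraph G (path_verts P)))"
proof
  let ?\<phi> = "\<lparr>src = induced_pair G P, tgt = induced_pair G Q, vmap = restrict f (path_verts P),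
    emap = restrict g (edges (induced_subgraph G (path_verts P)))\<rparr>"
  have "pair_iso v (induced_pair G P) (induced_pair G Q) (restrict f (path_verts P))
      (restrict g (edges (induced_subgraph G (path_verts P))))"
    using P iso by (rule pair_iso_cong) auto
  then show "?\<phi> \<in> Pisg G v"
    using assms(1,2) by (simp add: Pisg_def)
qed simp_all

text \<open>The inverse of \<open>\<phi>\<close> restricted to \<open>P\<close> yields the source of
  the product, \<open>\<psi>\<close> restricted to \<open>P\<close> its target; hence both ends are
  copies of the pair of \<open>P\<close>. If \<open>P\<close> is a full path, the corresponding end
  of the factor is kept.\<close>

lemma pisg_mult_props:
  fixes G :: "('v, 'e) ugraph"
  assumes \<phi>: "\<phi> \<in> Pisg G v" and \<psi>: "\<psi> \<in> Pisg G v"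
  defines "P \<equiv> common_path (snd (tgt \<phi>)) (snd (src \<psi>))"
  shows "pisg_mult G \<psi> \<phi> \<in> Pisg G v"
    and "pair_isomorphic v (src (pisg_mult G \<psi> \<phi>)) (induced_pair G P)"
    and "pair_isomorphic v (tgt (pisg_mult G \<psi> \<phi>)) (induced_pair G P)"
    and "rooted_subpath P (snd (tgt \<phi>))" "rooted_subpath P (snd (src \<psi>))"
    and "P = snd (tgt \<phi>) \<Longrightarrow> src (pisg_mult G \<psi> \<phi>) = src \<phi>"
    and "P = snd (src \<psi>) \<Longrightarrow> tgt (pisg_mult G \<psi> \<phi>) = tgt \<psi>"
    and "vmap (pisg_mult G \<psi> \<phi>) =
      compose (verts (fst (src (pisg_mult G \<psi> \<phi>)))) (vmap \<psi>) (vmap \<phi>)"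
    and "emap (pisg_mult G \<psi> \<phi>) =
      compose (edges (fst (src (pisg_mult G \<psi> \<phi>)))) (emap \<psi>) (emap \<phi>)"
proof -
  obtain A B where A: "src \<phi> = induced_pair G A" "rooted_path G v A"
    and B: "tgt \<phi> = induced_pair G B" "rooted_path G v B"
    and iso1: "pair_iso v (induced_pair G A) (induced_pair G B) (vmap \<phi>) (emap \<phi>)"
    using \<phi> by (rule PisgD)
  obtain C D where C: "src \<psi> = induced_pair G C" "rooted_path G v C"
    and D: "tgt \<psi> = induced_pair G D" "rooted_path G v D"
    and iso2: "pair_iso v (induced_pair G C) (induced_pair G D) (vmap \<psi>) (emap \<psi>)"
    using \<psi> by (rule PisgD)
  let ?HA = "induced_subgraph G (path_verts A)"
  let ?f' = "inv_into (path_verts A) (vmap \<phi>)" and ?g' = "inv_into (edges ?HA) (emap \<phi>)"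
  let ?A = "path_image ?f' ?g' P" and ?D = "path_image (vmap \<psi>) (emap \<psi>) P"
  let ?HP = "induced_subgraph G (path_verts P)"
  have P_eq: "P = common_path B C"
    using B C by (simp add: P_def)
  have PB: "rooted_subpath P B" and PC: "rooted_subpath P C"
    using B C rooted_subpath_common_path[of B C] by (simp_all add: P_eq rooted_path_def)
  then show "rooted_subpath P (snd (tgt \<phi>))" "rooted_subpath P (snd (src \<psi>))"
    using B C by simp_all
  have P: "rooted_path G v P"
    using B PB by (blast intro: rooted_path_subpath)
  note inv1 = pair_iso_inv[OF A(2) iso1]
  note restr1 = pair_iso_restrict[OF inv1 PB]
  note restr2 = pair_iso_restrict[OF iso2 PC]
  have A': "rooted_path G v ?A" and D': "rooted_path G v ?D"
    using A D restr1(2) restr2(2) by (blast intro: rooted_path_subpath)+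
  have graphs: "graph_image ?f' ?g' ?HP = induced_subgraph G (path_verts ?A)"
    "graph_image (vmap \<psi>) (emap \<psi>) ?HP = induced_subgraph G (path_verts ?D)"
    using restr1(1) restr2(1) by (intro graph_image_eq; simp add: pair_iso_def)+
  have images: "?f' ` verts ?HP = path_verts ?A"
    "?g' ` edges ?HP = edges (induced_subgraph G (path_verts ?A))"
    using arg_cong[OF graphs(1), of verts] arg_cong[OF graphs(1), of edges]
    by (simp_all add: graph_image_def)
  have mult: "pisg_mult G \<psi> \<phi> =
      \<lparr>src = induced_pair G ?A, tgt = induced_pair G ?D,
       vmap = compose (path_verts ?A) (vmap \<psi>) (vmap \<phi>),
       emap = compose (edges (induced_subgraph G (path_verts ?A))) (emap \<psi>) (emap \<phi>)\<rparr>"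
    using A graphs images by (simp add: pisg_mult_def Let_def flip: P_def)
  \<comment> \<open>Restricting \<open>\<phi>\<close> to \<open>?A\<close> gives the image of
    \<open>?A\<close> as target path; it is \<open>P\<close> because \<open>\<phi>\<close> after its
    inverse is the identity on \<open>P\<close>.\<close>
  have "path_image (vmap \<phi>) (emap \<phi>) ?A = P"
  proof -
    have "vmap \<phi> (?f' x) = x" if "x \<in> path_verts P" for x
      using that iso1 path_verts_subpath[OF PB]
      by (auto simp: pair_iso_def graph_iso_def bij_betw_inv_into_right)
    moreover have "emap \<phi> (?g' e) = e" if "e \<in> fst ` set (snd P)" for e
      using rooted_path_edges[OF P that] iso1 path_verts_subpath[OF PB]
      by (auto simp: pair_iso_def graph_iso_def induced_subgraph_def
          intro!: bij_betw_inv_into_right)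
    ultimately have "path_image (vmap \<phi> \<circ> ?f') (emap \<phi> \<circ> ?g') P = path_image (\<lambda>x. x) (\<lambda>e. e) P"
      by (intro path_image_cong) simp_all
    then show ?thesis
      by (simp add: path_image_path_image path_image_id)
  qed
  then have iso1': "pair_iso v (induced_pair G ?A) (induced_pair G P) (vmap \<phi>) (emap \<phi>)"
    using pair_iso_restrict(1)[OF iso1 restr1(2)] by simp
  \<comment> \<open>\<open>compose\<close> agrees with ordinary composition on the source, so the
    composed isomorphism carries over.\<close>
  have "pair_iso v (induced_pair G ?A) (induced_pair G ?D)
      (compose (path_verts ?A) (vmap \<psi>) (vmap \<phi>))
      (compose (edges (induced_subgraph G (path_verts ?A))) (emap \<psi>) (emap \<phi>))"
    using A' pair_iso_comp[OF iso1' restr2(1)] by (rule pair_iso_cong) (auto simp: compose_def)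
  then show "pisg_mult G \<psi> \<phi> \<in> Pisg G v"
    using A' D' by (simp add: mult Pisg_def compose_def in_path_pairs_iff)
  show "pair_isomorphic v (src (pisg_mult G \<psi> \<phi>)) (induced_pair G P)"
    using iso1' by (auto simp: mult pair_isomorphic_def)
  show "pair_isomorphic v (tgt (pisg_mult G \<psi> \<phi>)) (induced_pair G P)"
    using pair_iso_inv[OF P restr2(1)] by (auto simp: mult pair_isomorphic_def)
  show "src (pisg_mult G \<psi> \<phi>) = src \<phi>" if "P = snd (tgt \<phi>)"
  proof -
    \<comment> \<open>Here \<open>P\<close> is \<open>B\<close>, and the inverse of
      \<open>\<phi>\<close> sends \<open>B\<close> to \<open>A\<close>.\<close>
    have "?A = A"
      using that B inv1 by (simp add: pair_iso_def)
    then show ?thesis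
      using A unfolding mult by simp
  qed
  show "tgt (pisg_mult G \<psi> \<phi>) = tgt \<psi>" if "P = snd (src \<psi>)"
  proof -
    have "?D = D"
      using that C iso2 by (simp add: pair_iso_def)
    then show ?thesis
      using D unfolding mult by simp
  qed
  show "vmap (pisg_mult G \<psi> \<phi>) =
      compose (verts (fst (src (pisg_mult G \<psi> \<phi>)))) (vmap \<psi>) (vmap \<phi>)"
    "emap (pisg_mult G \<psi> \<phi>) =
      compose (edges (fst (src (pisg_mult G \<psi> \<phi>)))) (emap \<psi>) (emap \<phi>)"
    by (simp_all add: mult)
qed

section \<open>Transport of subpaths and left division\<close>

lemma pair_isomorphic_trans:
  "pair_isomorphic v A B \<Longrightarrow> pair_isomorphic v B C \<Longrightarrow> pair_isomorphic v A C"
  unfolding pair_isomorphic_def by (blast intro: pair_iso_comp)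

lemma pair_isomorphic_subpath:
  assumes "pair_isomorphic v (induced_pair G P) (induced_pair G Q)" and "rooted_subpath P' P"
  obtains Q' where "rooted_subpath Q' Q"
    and "pair_isomorphic v (induced_pair G P') (induced_pair G Q')"
  using assms pair_iso_restrict unfolding pair_isomorphic_def by metis

text \<open>The quotient is \<phi> x^-1. Its source is the target of \<open>x\<close>, so the
  product with \<open>x\<close> loses nothing and x^-1 x cancels on the common source.\<close>

lemma Pisg_left_divide:
  assumes x: "x \<in> Pisg G v" and \<phi>: "\<phi> \<in> Pisg G v" and src: "src x = src \<phi>"
  obtains y where "y \<in> Pisg G v" "pisg_mult G y x = \<phi>"
proof -
  obtain A B where A: "src x = induced_pair G A" "rooted_path G v A"
    and B: "tgt x = induced_pair G B" "rooted_path G v B"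
    and iso1: "pair_iso v (induced_pair G A) (induced_pair G B) (vmap x) (emap x)"
    using x by (rule PisgD)
  obtain A' D where A': "src \<phi> = induced_pair G A'" "rooted_path G v A'"
    and D: "tgt \<phi> = induced_pair G D" "rooted_path G v D"
    and iso2: "pair_iso v (induced_pair G A') (induced_pair G D) (vmap \<phi>) (emap \<phi>)"
    and ext: "vmap \<phi> \<in> extensional (path_verts A')"
      "emap \<phi> \<in> extensional (edges (induced_subgraph G (path_verts A')))"
    using \<phi> by (rule PisgD)
  have [simp]: "A' = A"
    using A A' src by simp
  let ?EA = "edges (induced_subgraph G (path_verts A))"
  let ?EB = "edges (induced_subgraph G (path_verts B))"
  let ?f = "vmap \<phi> \<circ> inv_into (path_verts A) (vmap x)" and ?g = "emap \<phi> \<circ> inv_into ?EA (emap x)"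
  have "pair_iso v (induced_pair G B) (induced_pair G D) ?f ?g"
    using pair_iso_comp[OF pair_iso_inv[OF A(2) iso1]] iso2 by simp
  then obtain y where y: "y \<in> Pisg G v" "src y = induced_pair G B" "tgt y = induced_pair G D"
    "vmap y = restrict ?f (path_verts B)" "emap y = restrict ?g ?EB"
    using B D by (elim pair_iso_PisgE[rotated 2])
  note m = pisg_mult_props[OF x y(1)]
  \<comment> \<open>\<open>x\<close> ends on exactly the path at which \<open>y\<close> starts, so
    the product has the full source of \<open>x\<close> and the full target of
    \<open>y\<close>.\<close>
  have common: "common_path (snd (tgt x)) (snd (src y)) = B"
    using B y by (simp add: common_path_subpath)
  have s: "src (pisg_mult G y x) = induced_pair G A" and t: "tgt (pisg_mult G y x) = tgt \<phi>"
    using m(6,7) common A B D y by simp_all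
  from iso1 have vx: "bij_betw (vmap x) (path_verts A) (path_verts B)"
    and ex: "bij_betw (emap x) ?EA ?EB"
    by (auto simp: pair_iso_def graph_iso_def)
  \<comment> \<open>On \<open>path_verts A\<close>, \<open>vmap x\<close> leads into
    \<open>path_verts B\<close>, where \<open>vmap y\<close> is \<open>?f\<close> and the inverse
    cancels; elsewhere both sides are \<open>undefined\<close>.\<close>
  have "vmap (pisg_mult G y x) = vmap \<phi>"
  proof (rule extensionalityI)
    show "vmap (pisg_mult G y x) \<in> extensional (path_verts A)"
      by (simp add: m(8) s compose_def)
    show "vmap (pisg_mult G y x) u = vmap \<phi> u" if "u \<in> path_verts A" for u
      using that vx by (simp add: m(8) s compose_def y(4) bij_betw_inv_into_left bij_betw_apply)
  qed (use ext in simp)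
  moreover have "emap (pisg_mult G y x) = emap \<phi>"
  proof (rule extensionalityI)
    show "emap (pisg_mult G y x) \<in> extensional ?EA"
      by (simp add: m(9) s compose_def)
    show "emap (pisg_mult G y x) e = emap \<phi> e" if "e \<in> ?EA" for e
      using that ex by (simp add: m(9) s compose_def y(5) bij_betw_inv_into_left bij_betw_apply)
  qed (use ext in simp)
  ultimately have "pisg_mult G y x = \<phi>"
    using s t A src by simp
  with y(1) show thesis
    by (rule that)
qed

section \<open>The generated ideal and its minimality\<close>

lemma generated_ideal_subset_Pisg: "generated_ideal G v a \<subseteq> Pisg G v"
  by (auto simp: generated_ideal_def)

text \<open>Tailored to products with a member of the set: \<open>B\<close> is the end of that
  member where the factors meet, \<open>P\<close> the common path, and \<open>R\<close> the subpath
  of P_L whose pair is isomorphic to \<open>B\<close>. The copy \<open>R'\<close> of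
  \<open>P\<close> in \<open>R\<close> is the witness.\<close>

lemma generated_idealI:
  assumes "\<phi> \<in> Pisg G v" and "B \<in> path_pairs G v" and "rooted_subpath P (snd B)"
    and "pair_isomorphic v (src \<phi>) (induced_pair G P)"
    and "pair_isomorphic v (tgt \<phi>) (induced_pair G P)"
    and "pair_isomorphic v B (induced_pair G R)" and "rooted_subpath R (snd (src a))"
  shows "\<phi> \<in> generated_ideal G v a"
proof -
  have B: "B = induced_pair G (snd B)"
    using assms(2) by (simp add: in_path_pairs_iff)
  have "pair_isomorphic v (induced_pair G (snd B)) (induced_pair G R)"
    using assms(6) by (simp only: B[symmetric])
  then obtain R' where R': "rooted_subpath R' R"
    and iso: "pair_isomorphic v (induced_pair G P) (induced_pair G R')"
    using assms(3) by (rule pair_isomorphic_subpath)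
  show ?thesis
    unfolding generated_ideal_def
    using assms(1) rooted_subpath_trans[OF R' assms(7)] pair_isomorphic_trans[OF assms(4) iso]
      pair_isomorphic_trans[OF assms(5) iso]
    by (intro CollectI conjI exI[of _ R'])
qed

lemma semigroup_ideal_generated_ideal:
  "semigroup_ideal (Pisg G v) (pisg_mult G) (generated_ideal G v a)"
  unfolding semigroup_ideal_def
proof (intro conjI ballI generated_ideal_subset_Pisg)
  fix s x assume s: "s \<in> Pisg G v" and x_gen: "x \<in> generated_ideal G v a"
  then have x: "x \<in> Pisg G v"
    by (simp add: generated_ideal_def)
  obtain R where R: "rooted_subpath R (snd (src a))"
    "pair_isomorphic v (src x) (induced_pair G R)" "pair_isomorphic v (tgt x) (induced_pair G R)"
    using x_gen by (auto simp: generated_ideal_def)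
  from x have pairs: "src x \<in> path_pairs G v" "tgt x \<in> path_pairs G v"
    by (auto simp: Pisg_def)
  \<comment> \<open>Here \<open>x\<close> acts first, so the common path is an initial segment of
    its target path; in the other product \<open>x\<close> acts second and its source path takes
    this role.\<close>
  show "pisg_mult G s x \<in> generated_ideal G v a"
    using pisg_mult_props(1)[OF x s] pairs(2) pisg_mult_props(4,2,3)[OF x s] R(3,1)
    by (rule generated_idealI)
  show "pisg_mult G x s \<in> generated_ideal G v a"
    using pisg_mult_props(1)[OF s x] pairs(1) pisg_mult_props(5,2,3)[OF s x] R(2,1)
    by (rule generated_idealI)
qed

text \<open>The witness is the full source path of \<open>a\<close>; its pair is isomorphic to
  itself by going to the target and back.\<close>

lemma in_generated_ideal_self:
  assumes "a \<in> Pisg G v"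
  shows "a \<in> generated_ideal G v a"
proof -
  obtain A B where A: "src a = induced_pair G A" "rooted_path G v A"
    and B: "tgt a = induced_pair G B"
    and iso: "pair_iso v (induced_pair G A) (induced_pair G B) (vmap a) (emap a)"
    using assms by (rule PisgD)
  have BA: "pair_isomorphic v (induced_pair G B) (induced_pair G A)"
    using pair_iso_inv[OF A(2) iso] by (auto simp: pair_isomorphic_def)
  moreover have "pair_isomorphic v (induced_pair G A) (induced_pair G A)"
    using iso BA by (blast intro: pair_isomorphic_trans pair_isomorphic_def[THEN iffD2])
  ultimately show ?thesis
    using assms A B unfolding generated_ideal_def by (intro CollectI conjI exI[of _ A]) simp_all
qed

lemma generated_ideal_minimal:
  assumes a: "a \<in> Pisg G v" and I: "semigroup_ideal (Pisg G v) (pisg_mult G) I" "a \<in> I"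
  shows "generated_ideal G v a \<subseteq> I"
proof
  fix \<phi> assume "\<phi> \<in> generated_ideal G v a"
  then obtain P f g where \<phi>: "\<phi> \<in> Pisg G v" and P: "rooted_subpath P (snd (src a))"
    and iso: "pair_iso v (src \<phi>) (induced_pair G P) f g"
    by (auto simp: generated_ideal_def pair_isomorphic_def)
  from \<phi> have Q: "src \<phi> = induced_pair G (snd (src \<phi>))" "rooted_path G v (snd (src \<phi>))"
    by (auto simp: Pisg_def in_path_pairs_iff)
  have "rooted_path G v (snd (src a))"
    using a by (auto simp: Pisg_def in_path_pairs_iff)
  then have "rooted_path G v P"
    using P by (rule rooted_path_subpath)
  \<comment> \<open>The restrictions of \<open>f\<close> and \<open>g\<close> form an element
    \<open>h\<close> with the source of \<open>\<phi>\<close>, ending on a subpath of P_L.\<close>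
  then obtain h where h: "h \<in> Pisg G v" "src h = src \<phi>" "tgt h = induced_pair G P"
    using pair_iso_PisgE[OF Q(2)] iso Q(1) by metis
  \<comment> \<open>The target path of \<open>h\<close> is an initial segment of the source path of
    \<open>a\<close>, so \<open>a\<close> after \<open>h\<close> keeps the source of
    \<open>h\<close>, and \<open>\<phi>\<close> can be divided by this product.\<close>
  have "common_path (snd (tgt h)) (snd (src a)) = snd (tgt h)"
    using P h by (simp add: common_path_subpath)
  then have "src (pisg_mult G a h) = src \<phi>"
    using pisg_mult_props(6)[OF h(1) a] h by simp
  then obtain y where "y \<in> Pisg G v" "pisg_mult G y (pisg_mult G a h) = \<phi>"
    using Pisg_left_divide[OF pisg_mult_props(1)[OF h(1) a] \<phi>] by blast
  \<comment> \<open>\<open>I\<close> contains \<open>a\<close>, hence absorbs \<open>h\<close> on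
    the right and then \<open>y\<close> on the left.\<close>
  moreover have "pisg_mult G a h \<in> I"
    using I h by (auto simp: semigroup_ideal_def)
  ultimately show "\<phi> \<in> I"
    using I by (auto simp: semigroup_ideal_def)
qed

theorem theorem4p23:
  fixes G :: "('v, 'e) ugraph" and v :: 'v and a :: "('v, 'e) pair_map"
  assumes "fin_ugraph G" and "v \<in> verts G" and "a \<in> Pisg G v"
  shows "semigroup_ideal (Pisg G v) (pisg_mult G) (generated_ideal G v a) \<and>
         a \<in> generated_ideal G v a \<and>
         (\<forall>I. semigroup_ideal (Pisg G v) (pisg_mult G) I \<and> a \<in> I \<longrightarrow> generated_ideal G v a \<subseteq> I)"
  using semigroup_ideal_generated_ideal in_generated_ideal_self[OF assms(3)]
    generated_ideal_minimal[OF assms(3)]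
  by (intro conjI allI impI) auto

end
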